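(* Let $\kappa$ and $\lambda$ be infinite cardinal numbers with $\lambda<\operatorname{cf}(\kappa)$, and let $\{X_\alpha : \alpha<\lambda\}$ be a family of infinite topological spaces, each of which has precaliber $\kappa$. Then the topological product $\prod\{X_\alpha : \alpha<\lambda\}$ has precaliber $\kappa$ as well.
   Context: For a topological space $X$, $\tau_X^{+}$ denotes the set of all non-empty open subsets of $X$. For an infinite cardinal $\kappa$, $\operatorname{cf}(\kappa)$ is its cofinality (in the usual sense), and $[I]^{\kappa}$ denotes $\{J\subseteq I : |J|=\kappa\}$. An indexed family $\{U_\gamma : \gamma\in J\}\subseteq\tau_X^{+}$ (repetitions allowed, $J\neq\emptyset$) is centered if $\bigcap\{U_\gamma : \gamma\in F\}\neq\emptyset$ for every non-empty finite $F\subseteq J$. A space $X$ has precaliber $\kappa$ (equivalently, $\kappa$ is a precaliber for $X$) if for every set $I$ of cardinality $\kappa$ and every indexed family $\{U_\gamma : \gamma\in I\}\subseteq\tau_X^{+}$ (repetitions allowed) there is $J\in[I]^{\kappa}$ such that $\{U_\gamma : \gamma\in J\}$ is centered. Products carry the product (Tychonoff) topology. No separation axioms are assumed. *)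

theory Defs
  imports "HOL-Analysis.Analysis"
begin

no_notation elt_set_eq (infix \<open>=o\<close> 50)
unbundle cardinal_syntax

text \<open>Cardinals are the library's cardinal orders: an infinite cardinal \<open>\<kappa>\<close> is a relation with
  \<open>Cinfinite \<kappa>\<close>, its elements (the ordinals below \<open>\<kappa>\<close>) form \<open>Field \<kappa>\<close>, and \<open>|J| =o \<kappa>\<close> says that
  the set \<open>J\<close> has cardinality \<open>\<kappa>\<close>.\<close>

text \<open>The least cardinality of a cofinal subset.  The library's \<open>cofinal A r\<close> asks for elements of
  \<open>A\<close> strictly above each element of \<open>Field r\<close>; as an infinite cardinal has no greatest element,
  this is there the same as cofinality in the weak sense.  The choice of \<open>A\<close> only affects the result
  up to \<open>=o\<close>.  Not meaningful for nonzero finite \<open>r\<close>, which have no strictly cofinal subset.\<close>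

definition cofinality :: "'k rel \<Rightarrow> 'k rel" where
  "cofinality r = |SOME A. A \<subseteq> Field r \<and> cofinal A r \<and>
     (\<forall>B. B \<subseteq> Field r \<and> cofinal B r \<longrightarrow> |A| \<le>o |B| )|"

lemma cofinality_attained:
  assumes "Cinfinite r"
  obtains A where "A \<subseteq> Field r" "cofinal A r" "cofinality r = |A|"
    "\<And>B. B \<subseteq> Field r \<Longrightarrow> cofinal B r \<Longrightarrow> |A| \<le>o |B|"
proof -
  define P where "P A \<longleftrightarrow> A \<subseteq> Field r \<and> cofinal A r" for A
  have "P (Field r)"
    unfolding P_def cofinal_def
    by (intro conjI subset_refl ballI infinite_Card_order_limit) (use assms in \<open>simp_all add: cinfinite_def\<close>)
  then obtain A where A: "A \<in> Collect P"
      and min: "\<forall>B. (B, A) \<in> inv_image ordLess (\<lambda>A. |A| ) \<longrightarrow> B \<notin> Collect P"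
    using wf_inv_image[OF wf_ordLess, of "\<lambda>A :: 'a set. |A|", unfolded wf_eq_minimal,
      rule_format, of "Field r" "Collect P"] by auto
  have "|A| \<le>o |B|" if "P B" for B
  proof -
    have "\<not> |B| <o |A|"
      using min[rule_format, of B] that by (auto simp: in_inv_image)
    then show ?thesis
      using not_ordLess_iff_ordLeq[OF card_of_Well_order card_of_Well_order] by blast
  qed
  with A have "\<exists>A. A \<subseteq> Field r \<and> cofinal A r \<and> (\<forall>B. B \<subseteq> Field r \<and> cofinal B r \<longrightarrow> |A| \<le>o |B| )"
    unfolding P_def by blast
  from someI_ex[OF this] show thesis
    by (intro that) (auto simp only: cofinality_def)
qed

definition centered :: "('i \<Rightarrow> 'a set) \<Rightarrow> 'i set \<Rightarrow> bool" where
  "centered U J \<longleftrightarrow> J \<noteq> {} \<and> (\<forall>F. F \<subseteq> J \<and> finite F \<and> F \<noteq> {} \<longrightarrow> (\<Inter>\<gamma>\<in>F. U \<gamma>) \<noteq> {})"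

text \<open>The index sets \<open>I\<close> range over the subsets of the type underlying \<open>\<kappa>\<close>, since a definition
  cannot quantify over types; \<open>has_precaliber_any_index\<close> extends it to index sets of every type.\<close>

definition has_precaliber :: "'a topology \<Rightarrow> 'k rel \<Rightarrow> bool" where
  "has_precaliber X \<kappa> \<longleftrightarrow>
     (\<forall>(I :: 'k set) U. |I| =o \<kappa> \<and> (\<forall>\<gamma>\<in>I. openin X (U \<gamma>) \<and> U \<gamma> \<noteq> {}) \<longrightarrow>
        (\<exists>J. J \<subseteq> I \<and> |J| =o \<kappa> \<and> centered U J))"

lemma has_precaliber_any_index:
  fixes I :: "'i set" and U :: "'i \<Rightarrow> 'a set" and \<kappa> :: "'k rel"
  assumes "Card_order \<kappa>" and X: "has_precaliber X \<kappa>" and I: "|I| =o \<kappa>"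
    and U: "\<And>\<gamma>. \<gamma> \<in> I \<Longrightarrow> openin X (U \<gamma>) \<and> U \<gamma> \<noteq> {}"
  shows "\<exists>J. J \<subseteq> I \<and> |J| =o \<kappa> \<and> centered U J"
proof -
  have F: "|Field \<kappa>| =o \<kappa>"
    by (rule card_of_Field_ordIso) fact
  then have "|Field \<kappa>| =o |I|"
    using I ordIso_symmetric ordIso_transitive by blast
  then obtain f where f: "bij_betw f (Field \<kappa>) I"
    using card_of_ordIso by blast
  have "\<forall>\<gamma>\<in>Field \<kappa>. openin X ((U \<circ> f) \<gamma>) \<and> (U \<circ> f) \<gamma> \<noteq> {}"
    using U bij_betwE[OF f] by simp
  with X F obtain J where J: "J \<subseteq> Field \<kappa>" "|J| =o \<kappa>" "centered (U \<circ> f) J"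
    unfolding has_precaliber_def by blast
  have "bij_betw f J (f ` J)"
    using f J(1) bij_betw_subset by blast
  then have "|f ` J| =o \<kappa>"
    using J(2) card_of_ordIsoI ordIso_symmetric ordIso_transitive by blast
  moreover have "f ` J \<subseteq> I"
    using f J(1) by (auto simp: bij_betw_def)
  moreover have "centered U (f ` J)"
    unfolding centered_def
  proof (intro conjI allI impI)
    show "f ` J \<noteq> {}"
      using J(3) by (simp add: centered_def)
    fix F assume "F \<subseteq> f ` J \<and> finite F \<and> F \<noteq> {}"
    then obtain G where "G \<subseteq> J" "finite G" "F = f ` G" "G \<noteq> {}"
      by (metis finite_subset_image image_is_empty)
    then show "(\<Inter>\<gamma>\<in>F. U \<gamma>) \<noteq> {}"
      using J(3) by (auto simp: centered_def image_image)
  qed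
  ultimately show ?thesis
    by blast
qed

end

theory Submission
  imports Defs "HOL-Algebra.Free_Abelian_Groups"
begin

text \<open>
  Shrink the given \<open>\<kappa>\<close> open sets to non-empty basic open boxes; each box restricts only finitely many
  coordinates.  There are only \<open>\<mu>\<close> finite sets of coordinates and \<open>\<mu> < cf \<kappa>\<close>, so \<open>\<kappa>\<close> many of the boxes
  restrict one and the same finite set \<open>F\<close> (\<open>large_fibre\<close>).  This pigeonhole principle also holds
  for singular \<open>\<kappa>\<close>: if all the classes had size below \<open>\<kappa>\<close>, their sizes would be bounded below \<open>\<kappa>\<close>,
  since fewer than \<open>cf \<kappa>\<close> ordinals cannot be cofinal in \<open>\<kappa>\<close>, and so their union would have size
  below \<open>\<kappa>\<close>.

  Now thin out this subfamily once for each coordinate in \<open>F\<close>, using the precaliber of that factor;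
  \<open>\<kappa>\<close> many boxes remain and their projections to every coordinate in \<open>F\<close> are centered
  (\<open>centered_on_finitely_many_factors\<close>).  Finitely many of the remaining boxes have a common point,
  chosen coordinate by coordinate: on \<open>F\<close> by centeredness, elsewhere arbitrarily, since there the
  boxes are unrestricted.
\<close>

lemma cofinality_le:
  assumes "Cinfinite \<kappa>"
  shows "cofinality \<kappa> \<le>o \<kappa>"
proof -
  obtain A where A: "A \<subseteq> Field \<kappa>" "cofinality \<kappa> = |A|"
    by (rule cofinality_attained[OF assms]) blast
  have "|A| \<le>o |Field \<kappa>|"
    using A(1) by (rule card_of_mono1)
  also have "|Field \<kappa>| =o \<kappa>"
    using assms by (intro card_of_Field_ordIso) simp
  finally show ?thesis
    unfolding A(2) .
qed

text \<open>The contrapositive of the minimality of the cofinality; linearity of \<open>\<kappa>\<close> turns non-cofinality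
  into boundedness.\<close>

lemma bounded_if_less_cofinality:
  assumes \<kappa>: "Cinfinite \<kappa>" and K: "K \<subseteq> Field \<kappa>" "|K| <o cofinality \<kappa>"
  obtains b where "b \<in> Field \<kappa>" "\<And>k. k \<in> K \<Longrightarrow> (k, b) \<in> \<kappa>"
proof -
  have "\<not> cofinal K \<kappa>"
  proof
    assume cof: "cofinal K \<kappa>"
    obtain A where "cofinality \<kappa> = |A|" "\<And>B. B \<subseteq> Field \<kappa> \<Longrightarrow> cofinal B \<kappa> \<Longrightarrow> |A| \<le>o |B|"
      by (rule cofinality_attained[OF \<kappa>]) (rule that; assumption)
    with K(1) cof have "cofinality \<kappa> \<le>o |K|"
      by simp
    with K(2) show False
      by (simp add: not_ordLess_ordLeq)
  qed
  then obtain b where b: "b \<in> Field \<kappa>" "\<And>k. k \<in> K \<Longrightarrow> b = k \<or> (b, k) \<notin> \<kappa>"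
    unfolding cofinal_def by blast
  have "Well_order \<kappa>"
    using \<kappa> card_order_on_well_order_on by blast
  then have "Refl \<kappa>" and "Total \<kappa>"
    by (simp_all add: order_on_defs)
  have "(k, b) \<in> \<kappa>" if "k \<in> K" for k
  proof (cases "b = k")
    case True
    with \<open>Refl \<kappa>\<close> b(1) show ?thesis
      by (simp add: refl_onD)
  next
    case False
    moreover have "k \<in> Field \<kappa>"
      using K(1) that by blast
    ultimately show ?thesis
      using \<open>Total \<kappa>\<close> b(1) b(2)[OF that] by (auto simp: total_on_def)
  qed
  with b(1) show thesis
    by (rule that)
qed

text \<open>A set of size below \<open>\<kappa>\<close> has at most the size of some proper initial segment of \<open>\<kappa>\<close>.
  If all fibres are that small, a common bound of the end points of these segments bounds the sizes of
  all fibres at once; this is where the cofinality enters.\<close>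

lemma large_fibre:
  assumes \<kappa>: "Cinfinite \<kappa>" and I: "|I| =o \<kappa>"
    and A: "|A| <o cofinality \<kappa>" and f: "f ` I \<subseteq> A"
  obtains a where "a \<in> A" "|{i \<in> I. f i = a}| =o \<kappa>"
proof (rule ccontr)
  assume "\<not> thesis"
  with that have none: "\<And>a. a \<in> A \<Longrightarrow> \<not> |{i \<in> I. f i = a}| =o \<kappa>"
    by blast
  define fibre where "fibre a = {i \<in> I. f i = a}" for a
  have wo: "Well_order \<kappa>" and co: "Card_order \<kappa>" and inf: "infinite (Field \<kappa>)"
    using \<kappa> card_order_on_well_order_on by (blast, blast, simp add: cinfinite_def)
  have small: "|fibre a| <o \<kappa>" if "a \<in> A" for a
  proof -
    have "|fibre a| \<le>o |I|"
      by (rule card_of_mono1) (auto simp: fibre_def)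
    then have "|fibre a| \<le>o \<kappa>"
      using I ordLeq_ordIso_trans by blast
    moreover have "\<not> |fibre a| =o \<kappa>"
      using none[OF that] by (simp add: fibre_def)
    ultimately show ?thesis
      using ordLeq_iff_ordLess_or_ordIso by blast
  qed
  have "\<exists>k. k \<in> Field \<kappa> \<and> |fibre a| \<le>o |underS \<kappa> k|" if "a \<in> A" for a
  proof -
    obtain k where k: "k \<in> Field \<kappa>" "|fibre a| =o Restr \<kappa> (underS \<kappa> k)"
      using small[OF \<open>a \<in> A\<close>] ordLess_iff_ordIso_Restr[OF wo card_of_Well_order] by blast
    have "|fibre a| \<le>o |Field (Restr \<kappa> (underS \<kappa> k))|"
      using card_of_cong[OF k(2)] Field_card_of ordIso_imp_ordLeq by metis
    also have "|Field (Restr \<kappa> (underS \<kappa> k))| \<le>o |underS \<kappa> k|"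
      by (rule card_of_mono1) (auto simp: Field_def)
    finally show ?thesis
      using k(1) by blast
  qed
  then obtain k where k: "\<And>a. a \<in> A \<Longrightarrow> k a \<in> Field \<kappa> \<and> |fibre a| \<le>o |underS \<kappa> (k a)|"
    by metis
  have k_sub: "k ` A \<subseteq> Field \<kappa>"
    using k by blast
  have k_less: "|k ` A| <o cofinality \<kappa>"
    using card_of_image A by (rule ordLeq_ordLess_trans)
  obtain b where b: "b \<in> Field \<kappa>" "\<And>a. a \<in> A \<Longrightarrow> (k a, b) \<in> \<kappa>"
    by (rule bounded_if_less_cofinality[OF \<kappa> k_sub k_less]) (simp add: that)
  have bound: "|fibre a| \<le>o |underS \<kappa> b|" if "a \<in> A" for a
  proof -
    have "underS \<kappa> (k a) \<subseteq> underS \<kappa> b"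
      using wo b(2)[OF that] by (intro underS_incr) (simp_all add: order_on_defs)
    then show ?thesis
      using k[OF that] card_of_mono1 ordLeq_transitive by blast
  qed
  have "|A| <o \<kappa>"
    using A cofinality_le[OF \<kappa>] by (rule ordLess_ordLeq_trans)
  have "I = (\<Union>a\<in>A. fibre a)"
    using f by (auto simp: fibre_def)
  have "|I| \<le>o |SIGMA a : A. underS \<kappa> b|"
  proof -
    have "|\<Union>a\<in>A. fibre a| \<le>o |SIGMA a : A. fibre a|"
      by (rule card_of_UNION_Sigma)
    also have "|SIGMA a : A. fibre a| \<le>o |SIGMA a : A. underS \<kappa> b|"
      using bound by (intro card_of_Sigma_mono1) blast
    finally show ?thesis
      using \<open>I = _\<close> by simp
  qed
  moreover have "|SIGMA a : A. underS \<kappa> b| <o \<kappa>"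
    using card_of_Times_ordLess_infinite_Field[OF inf co] \<open>|A| <o \<kappa>\<close> card_of_underS[OF co b(1)] by blast
  ultimately have "|I| <o \<kappa>"
    by (rule ordLeq_ordLess_trans)
  then show False
    using I not_ordLess_ordIso by blast
qed

lemma centered_subset:
  assumes "centered U J" "J' \<subseteq> J" "J' \<noteq> {}"
  shows "centered U J'"
  using assms unfolding centered_def by blast

text \<open>Coordinates can be treated one after the other because thinning out for a new coordinate keeps
  the earlier projections centered; finiteness of \<open>F\<close> matters because such a chain of thinnings
  need not leave \<open>\<kappa>\<close> many indices at a limit stage.\<close>

lemma centered_on_finitely_many_factors:
  assumes "finite F" and \<kappa>: "Cinfinite \<kappa>" and "|I| =o \<kappa>"
    and "\<And>\<alpha>. \<alpha> \<in> F \<Longrightarrow> has_precaliber (X \<alpha>) \<kappa>"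
    and "\<And>\<gamma> \<alpha>. \<gamma> \<in> I \<Longrightarrow> \<alpha> \<in> F \<Longrightarrow> openin (X \<alpha>) (V \<gamma> \<alpha>) \<and> V \<gamma> \<alpha> \<noteq> {}"
  shows "\<exists>J\<subseteq>I. |J| =o \<kappa> \<and> (\<forall>\<alpha>\<in>F. centered (\<lambda>\<gamma>. V \<gamma> \<alpha>) J)"
  using assms(1,4,5)
proof (induction F rule: finite_induct)
  case empty
  show ?case
    using \<open>|I| =o \<kappa>\<close> by blast
next
  case (insert \<beta> F)
  then obtain J where J: "J \<subseteq> I" "|J| =o \<kappa>" "\<forall>\<alpha>\<in>F. centered (\<lambda>\<gamma>. V \<gamma> \<alpha>) J"
    by blast
  have "\<exists>J'. J' \<subseteq> J \<and> |J'| =o \<kappa> \<and> centered (\<lambda>\<gamma>. V \<gamma> \<beta>) J'"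
    using \<kappa> insert.prems J(1,2) by (intro has_precaliber_any_index[of \<kappa> "X \<beta>"]) auto
  then obtain J' where J': "J' \<subseteq> J" "|J'| =o \<kappa>" "centered (\<lambda>\<gamma>. V \<gamma> \<beta>) J'"
    by blast
  then have "J' \<noteq> {}"
    by (simp add: centered_def)
  with J(3) J'(1) have "\<forall>\<alpha>\<in>F. centered (\<lambda>\<gamma>. V \<gamma> \<alpha>) J'"
    using centered_subset by blast
  with J' show ?case
    using J(1) by (intro exI[of _ J']) auto
qed

theorem theorem3p3:
  fixes \<kappa> :: "'k rel" and \<mu> :: "'l rel" and X :: "'l \<Rightarrow> 'a topology"
  assumes "Cinfinite \<kappa>" and "Cinfinite \<mu>"
    and "\<mu> <o cofinality \<kappa>"
    and "\<And>\<alpha>. \<alpha> \<in> Field \<mu> \<Longrightarrow> infinite (topspace (X \<alpha>))"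
    and "\<And>\<alpha>. \<alpha> \<in> Field \<mu> \<Longrightarrow> has_precaliber (X \<alpha>) \<kappa>"
  shows "has_precaliber (product_topology X (Field \<mu>)) \<kappa>"
  unfolding has_precaliber_def
proof (intro allI impI)
  fix I :: "'k set" and U :: "'k \<Rightarrow> ('l \<Rightarrow> 'a) set"
  assume "|I| =o \<kappa> \<and> (\<forall>\<gamma>\<in>I. openin (product_topology X (Field \<mu>)) (U \<gamma>) \<and> U \<gamma> \<noteq> {})"
  then have I: "|I| =o \<kappa>"
    and U: "\<And>\<gamma>. \<gamma> \<in> I \<Longrightarrow> openin (product_topology X (Field \<mu>)) (U \<gamma>) \<and> U \<gamma> \<noteq> {}"
    by auto
  have "\<exists>V. finite {\<alpha> \<in> Field \<mu>. V \<alpha> \<noteq> topspace (X \<alpha>)} \<and> (\<forall>\<alpha>\<in>Field \<mu>. openin (X \<alpha>) (V \<alpha>)) \<and>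
      Pi\<^sub>E (Field \<mu>) V \<noteq> {} \<and> Pi\<^sub>E (Field \<mu>) V \<subseteq> U \<gamma>" if "\<gamma> \<in> I" for \<gamma>
    using U[OF that] unfolding openin_product_topology_alt by blast
  then have "\<exists>V. \<forall>\<gamma>\<in>I. finite {\<alpha> \<in> Field \<mu>. V \<gamma> \<alpha> \<noteq> topspace (X \<alpha>)} \<and>
      (\<forall>\<alpha>\<in>Field \<mu>. openin (X \<alpha>) (V \<gamma> \<alpha>)) \<and>
      Pi\<^sub>E (Field \<mu>) (V \<gamma>) \<noteq> {} \<and> Pi\<^sub>E (Field \<mu>) (V \<gamma>) \<subseteq> U \<gamma>"
    by (intro bchoice ballI)
  then obtain V where "\<forall>\<gamma>\<in>I. finite {\<alpha> \<in> Field \<mu>. V \<gamma> \<alpha> \<noteq> topspace (X \<alpha>)} \<and>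
      (\<forall>\<alpha>\<in>Field \<mu>. openin (X \<alpha>) (V \<gamma> \<alpha>)) \<and>
      Pi\<^sub>E (Field \<mu>) (V \<gamma>) \<noteq> {} \<and> Pi\<^sub>E (Field \<mu>) (V \<gamma>) \<subseteq> U \<gamma>"
    by (rule exE)
  then have V: "\<And>\<gamma>. \<gamma> \<in> I \<Longrightarrow> finite {\<alpha> \<in> Field \<mu>. V \<gamma> \<alpha> \<noteq> topspace (X \<alpha>)}"
      "\<And>\<gamma> \<alpha>. \<gamma> \<in> I \<Longrightarrow> \<alpha> \<in> Field \<mu> \<Longrightarrow> openin (X \<alpha>) (V \<gamma> \<alpha>)"
      "\<And>\<gamma>. \<gamma> \<in> I \<Longrightarrow> Pi\<^sub>E (Field \<mu>) (V \<gamma>) \<noteq> {}"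
      "\<And>\<gamma>. \<gamma> \<in> I \<Longrightarrow> Pi\<^sub>E (Field \<mu>) (V \<gamma>) \<subseteq> U \<gamma>"
    by blast+
  have V_ne: "V \<gamma> \<alpha> \<noteq> {}" if "\<gamma> \<in> I" "\<alpha> \<in> Field \<mu>" for \<gamma> \<alpha>
    using V(3)[OF that(1)] that(2) by (auto simp: PiE_eq_empty_iff)

  define supp where "supp \<gamma> = {\<alpha> \<in> Field \<mu>. V \<gamma> \<alpha> \<noteq> topspace (X \<alpha>)}" for \<gamma>
  have "|Fpow (Field \<mu>)| =o |Field \<mu>|"
    using assms(2) eqpoll_Fpow[of "Field \<mu>"]
    by (simp add: cinfinite_def eqpoll_iff_card_of_ordIso)
  also have "|Field \<mu>| =o \<mu>"
    using assms(2) by (intro card_of_Field_ordIso) simp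
  also note \<open>\<mu> <o cofinality \<kappa>\<close>
  finally have few: "|Fpow (Field \<mu>)| <o cofinality \<kappa>" .
  have supp: "supp ` I \<subseteq> Fpow (Field \<mu>)"
    using V(1) by (auto simp: supp_def Fpow_def)
  obtain F where F: "F \<in> Fpow (Field \<mu>)" "|{\<gamma> \<in> I. supp \<gamma> = F}| =o \<kappa>"
    by (rule large_fibre[OF assms(1) I few supp])

  have F_fin: "finite F" and F_sub: "F \<subseteq> Field \<mu>"
    using F(1) by (auto simp: Fpow_def)
  have V_F: "openin (X \<alpha>) (V \<gamma> \<alpha>) \<and> V \<gamma> \<alpha> \<noteq> {}"
    if "\<gamma> \<in> {\<gamma> \<in> I. supp \<gamma> = F}" "\<alpha> \<in> F" for \<gamma> \<alpha>
    using V(2) V_ne F_sub that by blast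
  have X_F: "has_precaliber (X \<alpha>) \<kappa>" if "\<alpha> \<in> F" for \<alpha>
    using assms(5) F_sub that by blast
  have "\<exists>J\<subseteq>{\<gamma> \<in> I. supp \<gamma> = F}. |J| =o \<kappa> \<and> (\<forall>\<alpha>\<in>F. centered (\<lambda>\<gamma>. V \<gamma> \<alpha>) J)"
    by (intro centered_on_finitely_many_factors[of F \<kappa> _ X] F_fin assms(1) F(2) X_F V_F)
  then obtain J where J: "J \<subseteq> {\<gamma> \<in> I. supp \<gamma> = F}" "|J| =o \<kappa>"
      "\<And>\<alpha>. \<alpha> \<in> F \<Longrightarrow> centered (\<lambda>\<gamma>. V \<gamma> \<alpha>) J"
    by blast

  have "centered U J"
    unfolding centered_def
  proof (intro conjI allI impI)
    \<comment> \<open>For \<open>F = {}\<close> the centeredness of the projections says nothing about \<open>J\<close>, so this has to come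
      from the cardinality.\<close>
    show "J \<noteq> {}"
    proof
      assume "J = {}"
      with J(2) have "finite (Field \<kappa>)"
        using card_of_ordIso_finite_Field[of \<kappa> "{} :: 'k set"] assms(1) ordIso_symmetric by auto
      then show False
        using assms(1) by (simp add: cinfinite_def)
    qed
    fix G assume G: "G \<subseteq> J \<and> finite G \<and> G \<noteq> {}"
    have "\<exists>x. \<forall>\<gamma>\<in>G. x \<in> V \<gamma> \<alpha>" if "\<alpha> \<in> Field \<mu>" for \<alpha>
    proof (cases "\<alpha> \<in> F")
      case True
      with J(3) G have "(\<Inter>\<gamma>\<in>G. V \<gamma> \<alpha>) \<noteq> {}"
        unfolding centered_def by blast
      then show ?thesis
        by blast
    next
      case False
      have "\<exists>x. x \<in> topspace (X \<alpha>)"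
        using assms(4)[OF that] by (metis ex_in_conv finite.emptyI)
      moreover have "V \<gamma> \<alpha> = topspace (X \<alpha>)" if "\<gamma> \<in> G" for \<gamma>
        using False G J(1) that \<open>\<alpha> \<in> Field \<mu>\<close> unfolding supp_def by blast
      ultimately show ?thesis
        by auto
    qed
    then obtain x where x: "\<And>\<alpha> \<gamma>. \<alpha> \<in> Field \<mu> \<Longrightarrow> \<gamma> \<in> G \<Longrightarrow> x \<alpha> \<in> V \<gamma> \<alpha>"
      by metis
    have "restrict x (Field \<mu>) \<in> U \<gamma>" if "\<gamma> \<in> G" for \<gamma>
    proof -
      have "restrict x (Field \<mu>) \<in> Pi\<^sub>E (Field \<mu>) (V \<gamma>)"
        using x that by auto
      moreover have "\<gamma> \<in> I"
        using that G J(1) by blast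
      ultimately show ?thesis
        using V(4) by blast
    qed
    then show "(\<Inter>\<gamma>\<in>G. U \<gamma>) \<noteq> {}"
      by blast
  qed
  with J(1,2) show "\<exists>J. J \<subseteq> I \<and> |J| =o \<kappa> \<and> centered U J"
    by blast
qed

end
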